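(* For every fixed $\epsilon\in(0,1/4)$ there is a constant $C_\epsilon>0$ and an algorithm with the following guarantee. Given any instance of the Multiplicative Bidding Problem such that (i) prices are multiplicative: $p_{ij}=p_iq_j$ for some $p_1,\dots,p_m>0$, $q_1,\dots,q_n>0$; (ii) values are monotone along rows: there is a permutation $\sigma$ of $[m]$ with $v_{\sigma(i)j}\ge v_{\sigma(i')j}$ for all $j\in[n]$ and all $i<i'$; and (iii) $p_{ij}<\epsilon B$ for all cells, the algorithm outputs a feasible multiplicative bid whose value is at least $\mathrm{OPT}/(C_\epsilon(1+\log_2 m))$, i.e., it is an $O(\log m)$-approximation.
   Context: An instance of the Multiplicative Bidding Problem consists of integers $m,n\ge 1$, prices $p_{ij}>0$ and values $v_{ij}\ge 0$ for every cell $(i,j)\in[m]\times[n]$, and a budget $B>0$. A multiplicative bid consists of nonnegative reals $r_1,\dots,r_m$ and $c_1,\dots,c_n$; cell $(i,j)$ is captured if $r_i c_j\ge p_{ij}$. The bid is feasible if the total price of captured cells is at most $B$, and its value is the total value of captured cells. $\mathrm{OPT}$ (individual bidding optimum): order all cells by nonincreasing $v_{ij}/p_{ij}$ (ties broken arbitrarily) and take the longest prefix with total price at most $B$; $\mathrm{OPT}$ denotes the total value of this set. *)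

theory Defs
  imports Complex_Main "HOL-Combinatorics.Permutations"
begin

section \<open>The Multiplicative Bidding Problem\<close>

record mbp =
  rows :: nat
  cols :: nat
  price :: "nat \<Rightarrow> nat \<Rightarrow> real"
  val :: "nat \<Rightarrow> nat \<Rightarrow> real"
  budget :: real

text \<open>Rows and columns are indexed from 0; entries of price and val outside cells are junk.\<close>

definition cells :: "mbp \<Rightarrow> (nat \<times> nat) set" where
  "cells I = {..<rows I} \<times> {..<cols I}"

definition mbp_instance :: "mbp \<Rightarrow> bool" where
  "mbp_instance I \<longleftrightarrow> rows I \<ge> 1 \<and> cols I \<ge> 1 \<and> budget I > 0 \<and>
     (\<forall>(i, j) \<in> cells I. price I i j > 0 \<and> val I i j \<ge> 0)"

definition total_price :: "mbp \<Rightarrow> (nat \<times> nat) set \<Rightarrow> real" where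
  "total_price I S = (\<Sum>(i, j)\<in>S. price I i j)"

definition total_val :: "mbp \<Rightarrow> (nat \<times> nat) set \<Rightarrow> real" where
  "total_val I S = (\<Sum>(i, j)\<in>S. val I i j)"

definition mult_bid :: "mbp \<Rightarrow> (nat \<Rightarrow> real) \<Rightarrow> (nat \<Rightarrow> real) \<Rightarrow> bool" where
  "mult_bid I r c \<longleftrightarrow> (\<forall>i<rows I. r i \<ge> 0) \<and> (\<forall>j<cols I. c j \<ge> 0)"

definition captured :: "mbp \<Rightarrow> (nat \<Rightarrow> real) \<Rightarrow> (nat \<Rightarrow> real) \<Rightarrow> (nat \<times> nat) set" where
  "captured I r c = {(i, j) \<in> cells I. r i * c j \<ge> price I i j}"

definition feasible_bid :: "mbp \<Rightarrow> (nat \<Rightarrow> real) \<Rightarrow> (nat \<Rightarrow> real) \<Rightarrow> bool" where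
  "feasible_bid I r c \<longleftrightarrow> mult_bid I r c \<and> total_price I (captured I r c) \<le> budget I"

definition bid_value :: "mbp \<Rightarrow> (nat \<Rightarrow> real) \<Rightarrow> (nat \<Rightarrow> real) \<Rightarrow> real" where
  "bid_value I r c = total_val I (captured I r c)"

text \<open>
  The individual bidding optimum depends on how ties in the ratio order are broken, so it is
  a function of the order used; every order satisfying the predicate below is legitimate.
\<close>

definition ratio_order :: "mbp \<Rightarrow> (nat \<times> nat) list \<Rightarrow> bool" where
  "ratio_order I xs \<longleftrightarrow> distinct xs \<and> set xs = cells I \<and>
     sorted_wrt (\<lambda>(i, j) (i', j'). val I i j / price I i j \<ge> val I i' j' / price I i' j') xs"

definition OPT :: "mbp \<Rightarrow> (nat \<times> nat) list \<Rightarrow> real" where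
  "OPT I xs =
     (let k = (GREATEST k. k \<le> length xs \<and> total_price I (set (take k xs)) \<le> budget I)
      in total_val I (set (take k xs)))"

definition multiplicative_prices :: "mbp \<Rightarrow> bool" where
  "multiplicative_prices I \<longleftrightarrow>
     (\<exists>p q. (\<forall>i<rows I. p i > 0) \<and> (\<forall>j<cols I. q j > 0) \<and>
            (\<forall>(i, j) \<in> cells I. price I i j = p i * q j))"

definition monotone_values :: "mbp \<Rightarrow> bool" where
  "monotone_values I \<longleftrightarrow>
     (\<exists>\<sigma>. \<sigma> permutes {..<rows I} \<and>
        (\<forall>j<cols I. \<forall>i i'. i < i' \<and> i' < rows I \<longrightarrow> val I (\<sigma> i) j \<ge> val I (\<sigma> i') j))"


section \<open>Algorithms: programs of a real random access machine\<close>

text \<open>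
  Instances have real data, so an algorithm is a program for a machine with exact real
  arithmetic. The machine has a memory of naturals (for counters and addresses) and a memory of
  reals, both with indirect addressing. The only real constants are (images of) naturals: an
  arbitrary real constant could encode an infinite table.
\<close>

datatype nexp =
    NConst nat
  | NMem nexp
  | NAdd nexp nexp
  | NSub nexp nexp
  | NMul nexp nexp
  | NDiv nexp nexp
  | NMod nexp nexp

datatype rexp =
    ROfNat nexp
  | RMem nexp
  | RAdd rexp rexp
  | RSub rexp rexp
  | RMul rexp rexp
  | RDiv rexp rexp

datatype bexp =
    NLess nexp nexp
  | RLess rexp rexp
  | BNot bexp
  | BAnd bexp bexp

datatype prog =
    Skip
  | NAssign nexp nexp
  | RAssign nexp rexp
  | Seq prog prog
  | Cond bexp prog prog
  | While bexp prog

record store =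
  nmem :: "nat \<Rightarrow> nat"
  rmem :: "nat \<Rightarrow> real"

primrec nval :: "nexp \<Rightarrow> store \<Rightarrow> nat" where
  "nval (NConst k) s = k"
| "nval (NMem a) s = nmem s (nval a s)"
| "nval (NAdd a b) s = nval a s + nval b s"
| "nval (NSub a b) s = nval a s - nval b s"
| "nval (NMul a b) s = nval a s * nval b s"
| "nval (NDiv a b) s = nval a s div nval b s"
| "nval (NMod a b) s = nval a s mod nval b s"

primrec rval :: "rexp \<Rightarrow> store \<Rightarrow> real" where
  "rval (ROfNat a) s = real (nval a s)"
| "rval (RMem a) s = rmem s (nval a s)"
| "rval (RAdd x y) s = rval x s + rval y s"
| "rval (RSub x y) s = rval x s - rval y s"
| "rval (RMul x y) s = rval x s * rval y s"
| "rval (RDiv x y) s = rval x s / rval y s"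

primrec bval :: "bexp \<Rightarrow> store \<Rightarrow> bool" where
  "bval (NLess a b) s \<longleftrightarrow> nval a s < nval b s"
| "bval (RLess x y) s \<longleftrightarrow> rval x s < rval y s"
| "bval (BNot b) s \<longleftrightarrow> \<not> bval b s"
| "bval (BAnd b c) s \<longleftrightarrow> bval b s \<and> bval c s"

inductive exec :: "prog \<Rightarrow> store \<Rightarrow> store \<Rightarrow> bool" where
  Skip: "exec Skip s s"
| NAssign: "exec (NAssign a e) s (s\<lparr>nmem := (nmem s)(nval a s := nval e s)\<rparr>)"
| RAssign: "exec (RAssign a x) s (s\<lparr>rmem := (rmem s)(nval a s := rval x s)\<rparr>)"
| Seq: "exec P s t \<Longrightarrow> exec Q t u \<Longrightarrow> exec (Seq P Q) s u"
| CondTrue: "bval b s \<Longrightarrow> exec P s t \<Longrightarrow> exec (Cond b P Q) s t"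
| CondFalse: "\<not> bval b s \<Longrightarrow> exec Q s t \<Longrightarrow> exec (Cond b P Q) s t"
| WhileFalse: "\<not> bval b s \<Longrightarrow> exec (While b P) s s"
| WhileTrue: "bval b s \<Longrightarrow> exec P s t \<Longrightarrow> exec (While b P) t u \<Longrightarrow> exec (While b P) s u"

inductive_cases exec_SkipE: "exec Skip s t"
inductive_cases exec_NAssignE: "exec (NAssign a e) s t"
inductive_cases exec_RAssignE: "exec (RAssign a x) s t"
inductive_cases exec_SeqE: "exec (Seq P Q) s t"
inductive_cases exec_CondE: "exec (Cond b P Q) s t"
inductive_cases exec_WhileE: "exec (While b P) s t"

text \<open>Execution is deterministic, so existence of a final store expresses termination.\<close>

lemma exec_deterministic: "exec P s t \<Longrightarrow> exec P s t' \<Longrightarrow> t' = t"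
proof (induction arbitrary: t' rule: exec.induct)
  case (Skip s)
  then show ?case by (rule exec_SkipE)
next
  case (NAssign a e s)
  then show ?case by (rule exec_NAssignE)
next
  case (RAssign a x s)
  then show ?case by (rule exec_RAssignE)
next
  case (Seq P s t Q u)
  from Seq.prems obtain v where "exec P s v" "exec Q v t'" by (rule exec_SeqE)
  with Seq.IH show ?case by metis
next
  case (CondTrue b s P t Q)
  from CondTrue.prems CondTrue.hyps(1) have "exec P s t'" by (auto elim: exec_CondE)
  with CondTrue.IH show ?case by metis
next
  case (CondFalse b s Q t P)
  from CondFalse.prems CondFalse.hyps(1) have "exec Q s t'" by (auto elim: exec_CondE)
  with CondFalse.IH show ?case by metis
next
  case (WhileFalse b s P)
  from WhileFalse.prems WhileFalse.hyps show ?case by (auto elim: exec_WhileE)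
next
  case (WhileTrue b s P t u)
  from WhileTrue.prems WhileTrue.hyps(1) obtain v
    where "exec P s v" "exec (While b P) v t'" by (auto elim: exec_WhileE)
  with WhileTrue.IH show ?case by metis
qed

text \<open>
  Input layout: the natural memory starts with the numbers of rows and columns, the real memory
  with the budget, followed by all prices and then all values, both row by row.
  Output layout: the row bids followed by the column bids, from real address 0 on.
\<close>

definition input_store :: "mbp \<Rightarrow> store" where
  "input_store I =
    (let m = rows I; n = cols I in
     \<lparr>nmem = (\<lambda>a. if a = 0 then m else if a = 1 then n else 0),
      rmem = (\<lambda>a. if a = 0 then budget I
                  else if a - 1 < m * n then price I ((a - 1) div n) ((a - 1) mod n)
                  else if a - 1 < 2 * (m * n)
                    then val I ((a - 1 - m * n) div n) ((a - 1 - m * n) mod n)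
                  else 0)\<rparr>)"

definition outputs_bid :: "prog \<Rightarrow> mbp \<Rightarrow> (nat \<Rightarrow> real) \<Rightarrow> (nat \<Rightarrow> real) \<Rightarrow> bool" where
  "outputs_bid A I r c \<longleftrightarrow>
     (\<exists>t. exec A (input_store I) t \<and>
          (\<forall>i<rows I. r i = rmem t i) \<and> (\<forall>j<cols I. c j = rmem t (rows I + j)))"

lemma cell_index_less:
  fixes i j m n :: nat
  assumes "i < m" "j < n"
  shows "i * n + j < m * n"
proof -
  have "i * n + j < Suc i * n" using assms by simp
  also have "\<dots> \<le> m * n" using assms by (intro mult_le_mono1) simp
  finally show ?thesis .
qed

lemma input_store_simps:
  shows "nmem (input_store I) 0 = rows I"
    and "nmem (input_store I) 1 = cols I"
    and "rmem (input_store I) 0 = budget I"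
    and "i < rows I \<Longrightarrow> j < cols I \<Longrightarrow>
           rmem (input_store I) (1 + i * cols I + j) = price I i j"
    and "i < rows I \<Longrightarrow> j < cols I \<Longrightarrow>
           rmem (input_store I) (1 + rows I * cols I + i * cols I + j) = val I i j"
  using cell_index_less[of i "rows I" j "cols I"] by (simp_all add: input_store_def Let_def mult.commute)

end

theory Submission imports Defs begin

text \<open>
  With multiplicative prices, a bid captures exactly a family of row sets, one per column, that is
  nested under inclusion. All such families arise from bids r_i = p_i / a_i and c_j = q_j * b_j with
  integers a_i, b_j in 0..m, so an optimal one is found by exhaustive search; running time
  is not constrained.

  To see that some nested family is good, thin the individual optimum to a set of price at
  most B / 2, losing a factor 4. Group rows into price classes of ratio 3/2 and take only the classes
  of one residue modulo L, where (3/2)^L is at least 4 m and L = O(log m). In each column, replace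
  the chosen rows of the highest class by equally many most valuable rows of that class, and add all
  rows of lower classes of the residue. The price at most doubles, the families are nested,
  and the best of the L residues keeps a fraction 1 / L of the value.
\<close>

section \<open>Combinatorics\<close>

text \<open>Induction on \<open>k\<close>. Take a maximal \<open>T\<close> of weight at most
  \<open>2 * b\<close>. If it is not all of \<open>A\<close>, adding any element, of weight at most
  \<open>b\<close>, overshoots, so \<open>T\<close> weighs more than \<open>b\<close> and the rest
  at most \<open>real k * b\<close> for the predecessor \<open>k\<close>. Either \<open>T\<close>
  has the required share of the value, or the rest is so valuable that the induction hypothesis
  supplies \<open>S\<close> inside it.\<close>

lemma exists_light_valuable_subset:
  fixes w v :: "'a \<Rightarrow> real"
  assumes "finite A" "\<And>x. x \<in> A \<Longrightarrow> w x \<le> b" "\<And>x. x \<in> A \<Longrightarrow> 0 \<le> v x"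
    and "sum w A \<le> real k * b" "0 < k" "0 < b"
  shows "\<exists>S\<subseteq>A. sum w S \<le> 2 * b \<and> sum v A \<le> real k * sum v S"
  using assms
proof (induction k arbitrary: A)
  case 0
  then show ?case by simp
next
  case (Suc k)
  have vA: "0 \<le> sum v A" using Suc.prems by (intro sum_nonneg) auto
  show ?case
  proof (cases "sum w A \<le> 2 * b")
    case True
    have "sum v A \<le> real (Suc k) * sum v A" using vA by (simp add: algebra_simps)
    with True show ?thesis by blast
  next
    case False
    have k0: "0 < k"
      using False Suc.prems by (cases k) auto
    let ?F = "{T. T \<subseteq> A \<and> sum w T \<le> 2 * b}"
    have "finite ?F" using Suc.prems(1) by simp
    moreover have "{} \<in> ?F" using Suc.prems by simp
    ultimately obtain T where T: "T \<in> ?F" and mx: "\<And>T'. T' \<in> ?F \<Longrightarrow> T \<subseteq> T' \<Longrightarrow> T' = T"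
      by (metis (no_types, lifting) finite_has_maximal2)
    have fT: "finite T" using T Suc.prems(1) finite_subset by blast
    have "T \<noteq> A" using T False by auto
    then obtain x where x: "x \<in> A" "x \<notin> T" using T by auto
    have "insert x T \<notin> ?F" using mx[of "insert x T"] x by auto
    with x T fT have "sum w T + w x > 2 * b" by auto
    with Suc.prems(2)[OF x(1)] have wT: "sum w T > b" by linarith
    have splitw: "sum w A = sum w T + sum w (A - T)" and splitv: "sum v A = sum v T + sum v (A - T)"
      using T sum.subset_diff[of T A w] sum.subset_diff[of T A v] Suc.prems(1) by auto
    have wr: "sum w (A - T) \<le> real k * b"
      using splitw wT Suc.prems(4) by (simp add: algebra_simps)
    show ?thesis
    proof (cases "sum v A \<le> real (Suc k) * sum v T")
      case True
      with T show ?thesis by blast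
    next
      case False
      obtain S where S: "S \<subseteq> A - T" "sum w S \<le> 2 * b" "sum v (A - T) \<le> real k * sum v S"
        using Suc.IH[of "A - T"] Suc.prems wr k0 by auto
      \<comment> \<open>The induction hypothesis is scaled by \<open>Suc k\<close>, and
        \<open>Suc k\<close> times the value of \<open>T\<close> is below that of \<open>A\<close>.
        Subtracting one copy of the value of \<open>A\<close> leaves the factor \<open>k\<close> on
        both sides, which is positive and cancels.\<close>
      have "real k * sum v A \<le> real k * (real (Suc k) * sum v S)"
      proof -
        have "real (Suc k) * sum v A
            \<le> real (Suc k) * sum v T + real (Suc k) * (real k * sum v S)"
          using splitv mult_left_mono[OF S(3), of "real (Suc k)"] by (simp add: algebra_simps)
        also have "\<dots> \<le> sum v A + real (Suc k) * (real k * sum v S)" using False by simp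
        finally show ?thesis by (simp add: algebra_simps)
      qed
      hence "sum v A \<le> real (Suc k) * sum v S" using k0 by simp
      with S show ?thesis by blast
    qed
  qed
qed

text \<open>A segment of size \<open>n\<close> is extended by the \<open>f\<close>-least remaining
  element; injectivity makes the comparison with the others strict.\<close>

lemma exists_initial_segment:
  fixes f :: "'a \<Rightarrow> nat"
  assumes "finite A" "inj_on f A" "n \<le> card A"
  shows "\<exists>Q\<subseteq>A. card Q = n \<and> (\<forall>x\<in>Q. \<forall>y\<in>A - Q. f x < f y)"
  using assms(3)
proof (induction n)
  case 0
  then show ?case by (intro exI[of _ "{}"]) auto
next
  case (Suc n)
  then obtain Q where Q: "Q \<subseteq> A" "card Q = n" "\<forall>x\<in>Q. \<forall>y\<in>A - Q. f x < f y" by auto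
  have "A - Q \<noteq> {}" using Suc.prems Q by (metis Diff_eq_empty_iff Suc_n_not_le_n subset_antisym)
  then obtain z where z: "z \<in> A - Q" "\<And>y. y \<in> A - Q \<Longrightarrow> f z \<le> f y"
    using arg_min_if_finite(1)[of "A - Q" f] arg_min_least[of "A - Q" _ f] assms(1)
    by (metis finite_Diff)
  have "f z < f y" if "y \<in> A - insert z Q" for y
    using z(1) z(2)[of y] that inj_onD[OF assms(2), of z y] by (cases "f z = f y") auto
  moreover have "card (insert z Q) = Suc n"
    using z Q finite_subset[OF Q(1) assms(1)] by simp
  ultimately show ?case using z Q by (intro exI[of _ "insert z Q"]) auto
qed

text \<open>Exchange argument: \<open>S - Q\<close> and \<open>Q - S\<close> have the same size, and
  any bijection from the former to the latter never decreases the value.\<close>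

lemma sum_le_sum_initial_segment:
  fixes v :: "'a \<Rightarrow> real"
  assumes "finite A" "Q \<subseteq> A" "S \<subseteq> A" "card Q = card S"
    and "\<And>x y. x \<in> Q \<Longrightarrow> y \<in> A - Q \<Longrightarrow> v y \<le> v x"
  shows "sum v S \<le> sum v Q"
proof -
  have fin: "finite Q" "finite S" using assms finite_subset by auto
  have "card (S - Q) = card (Q - S)"
    using card_Diff_subset_Int[of S Q] card_Diff_subset_Int[of Q S] fin assms(4)
    by (simp add: Int_commute)
  then obtain h where h: "bij_betw h (S - Q) (Q - S)"
    using finite_same_card_bij[of "S - Q" "Q - S"] fin by auto
  have "sum v (S - Q) \<le> sum (v \<circ> h) (S - Q)"
  proof (rule sum_mono)
    fix y assume "y \<in> S - Q"
    with h have "h y \<in> Q" by (auto dest: bij_betwE)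
    with \<open>y \<in> S - Q\<close> show "v y \<le> (v \<circ> h) y" using assms(3,5) by auto
  qed
  also have "\<dots> = sum v (Q - S)" using sum.reindex_bij_betw[OF h, of v] by simp
  finally have "sum v (S - Q) + sum v (S \<inter> Q) \<le> sum v (Q - S) + sum v (S \<inter> Q)" by simp
  moreover have "sum v S = sum v (S \<inter> Q) + sum v (S - Q)" "sum v Q = sum v (S \<inter> Q) + sum v (Q - S)"
    using sum.Int_Diff[of S v Q] sum.Int_Diff[of Q v S] fin by (simp_all add: Int_commute)
  ultimately show ?thesis by linarith
qed

section \<open>Geometric price classes and nested row sets\<close>

text \<open>Class \<open>c\<close> lies between the powers \<open>c\<close> and \<open>c + 1\<close>
  of 3/2. Distinct classes that agree modulo \<open>L\<close> are at least \<open>L\<close> apart,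
  so their lower ends differ by a factor of at least \<open>4 * M\<close>.\<close>

lemma log_three_halves_classes:
  fixes p :: "'a \<Rightarrow> real"
  assumes "\<And>i. i \<in> R \<Longrightarrow> 0 < p i" and "(3/2) ^ L \<ge> 4 * M" and "M > 0"
  defines "cls \<equiv> \<lambda>i. \<lfloor>log (3/2) (p i)\<rfloor>"
  shows "\<And>i i'. i \<in> R \<Longrightarrow> i' \<in> R \<Longrightarrow> cls i = cls i' \<Longrightarrow> p i \<le> 3/2 * p i'"
    and "\<And>i i'. i \<in> R \<Longrightarrow> i' \<in> R \<Longrightarrow> cls i < cls i' \<Longrightarrow> cls i mod int L = cls i' mod int L
           \<Longrightarrow> 2 * M * p i \<le> p i'"
proof -
  have lower: "(3/2) powr real_of_int (cls i) \<le> p i"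
    and upper: "p i \<le> (3/2) powr (real_of_int (cls i) + 1)" if "i \<in> R" for i
  proof -
    have p: "p i = (3/2) powr log (3/2) (p i)" using assms(1)[OF that] by simp
    show "(3/2) powr real_of_int (cls i) \<le> p i"
      by (subst p, rule powr_mono) (auto simp: cls_def)
    show "p i \<le> (3/2) powr (real_of_int (cls i) + 1)"
      by (subst p, rule powr_mono) (auto simp: cls_def intro: less_imp_le)
  qed
  fix i i' assume i: "i \<in> R" and i': "i' \<in> R"
  {
    assume "cls i = cls i'"
    with upper[OF i] lower[OF i'] show "p i \<le> 3/2 * p i'" by (simp add: powr_add)
  next
    assume less: "cls i < cls i'" and "cls i mod int L = cls i' mod int L"
    hence "int L dvd cls i' - cls i" by (metis mod_eq_dvd_iff)
    with less have "int L \<le> cls i' - cls i" by (intro zdvd_imp_le) auto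
    hence "real_of_int (cls i) + real L \<le> real_of_int (cls i')" by linarith
    hence "(3/2 :: real) powr (real_of_int (cls i) + real L) \<le> (3/2) powr real_of_int (cls i')"
      by (intro powr_mono) auto
    hence le: "(3/2 :: real) powr (real_of_int (cls i)) * (3/2) ^ L \<le> p i'"
      using lower[OF i'] by (simp add: powr_add powr_realpow)
    \<comment> \<open>Rounding \<open>p i\<close> up to the end of its class costs a factor 3/2 and
      turns \<open>2 * M\<close> into \<open>3 * M\<close>, which \<open>(3/2) ^ L\<close> still
      exceeds.\<close>
    have "2 * M * p i \<le> 2 * M * ((3/2) powr (real_of_int (cls i)) * (3/2))"
      using upper[OF i] assms(3) by (intro mult_left_mono) (auto simp: powr_add)
    also have "\<dots> = (3 * M) * (3/2) powr (real_of_int (cls i))" by simp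
    also have "\<dots> \<le> (3/2) ^ L * (3/2) powr (real_of_int (cls i))"
      using assms(2,3) by (intro mult_right_mono) auto
    also have "\<dots> \<le> p i'" using le by (simp add: mult.commute)
    finally show "2 * M * p i \<le> p i'" .
  }
qed

text \<open>Keeps what is used of the logarithmic classes: prices within a class differ by at most
  3/2, and a lower class of the same residue is cheaper by twice the number of rows.
  \<open>rk\<close> is the position of a row in the value order shared by all columns.\<close>

locale row_classes =
  fixes R :: "'a set" and p :: "'a \<Rightarrow> real" and cls :: "'a \<Rightarrow> int" and rk :: "'a \<Rightarrow> nat" and L :: nat
  assumes finR: "finite R" and p_pos: "i \<in> R \<Longrightarrow> 0 < p i" and inj: "inj_on rk R"
    and same: "i \<in> R \<Longrightarrow> i' \<in> R \<Longrightarrow> cls i = cls i' \<Longrightarrow> p i \<le> 3/2 * p i'"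
    and lower: "i \<in> R \<Longrightarrow> i' \<in> R \<Longrightarrow> cls i < cls i' \<Longrightarrow> cls i mod int L = cls i' mod int L
      \<Longrightarrow> 2 * real (card R) * p i \<le> p i'"
begin

text \<open>The initial segments of residue \<open>r\<close> in the lexicographic order by class,
  then rank. The order is independent of the column, which makes the sets chosen in different
  columns nested.\<close>

definition downset :: "int \<Rightarrow> 'a set \<Rightarrow> bool" where
  "downset r T \<longleftrightarrow> T \<subseteq> {i \<in> R. cls i mod int L = r} \<and>
     (\<forall>x\<in>T. \<forall>y\<in>R. cls y mod int L = r \<longrightarrow> cls y < cls x \<or> cls y = cls x \<and> rk y < rk x \<longrightarrow> y \<in> T)"

text \<open>Initial segments of a linear order are comparable: of two rows witnessing the contrary,
  the smaller one would lie in both sets.\<close>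

lemma downset_chain:
  assumes "downset r T" "downset r T'"
  shows "T \<subseteq> T' \<or> T' \<subseteq> T"
proof (rule ccontr)
  assume "\<not> ?thesis"
  then obtain x y where xy: "x \<in> T" "x \<notin> T'" "y \<in> T'" "y \<notin> T" by auto
  have "T \<subseteq> {i \<in> R. cls i mod int L = r}" "T' \<subseteq> {i \<in> R. cls i mod int L = r}"
    using assms by (simp_all add: downset_def)
  hence mem: "x \<in> R" "cls x mod int L = r" "y \<in> R" "cls y mod int L = r"
    using xy by auto
  have "x \<noteq> y" using xy by auto
  hence "rk x \<noteq> rk y" using inj mem by (auto dest: inj_onD)
  hence "(cls y < cls x \<or> cls y = cls x \<and> rk y < rk x) \<or> (cls x < cls y \<or> cls y = cls x \<and> rk x < rk y)"
    by linarith
  moreover have "y \<in> T" if "cls y < cls x \<or> cls y = cls x \<and> rk y < rk x"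
    using assms(1) xy(1) mem(3,4) that unfolding downset_def by blast
  moreover have "x \<in> T'" if "cls x < cls y \<or> cls x = cls y \<and> rk x < rk y"
    using assms(2) xy(3) mem(1,2) that unfolding downset_def by blast
  ultimately show False using xy(2,4) by auto
qed

text \<open>
  The set consists of an initial segment of the highest class met by S and of all lower rows
  with the same residue. The latter are so cheap that they all fit in half the price of one row.
\<close>

lemma downset_cover:
  fixes v :: "'a \<Rightarrow> real"
  assumes "S \<subseteq> R" and nonneg: "\<And>i. i \<in> R \<Longrightarrow> 0 \<le> v i"
    and mono: "\<And>i i'. i \<in> R \<Longrightarrow> i' \<in> R \<Longrightarrow> rk i < rk i' \<Longrightarrow> v i' \<le> v i"
  shows "\<exists>T. downset r T \<and> sum p T \<le> 2 * sum p S \<and> sum v {i \<in> S. cls i mod int L = r} \<le> sum v T"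
proof (cases "{i \<in> S. cls i mod int L = r} = {}")
  case True
  have "0 \<le> sum p S" using assms(1) p_pos by (intro sum_nonneg) (auto intro: less_imp_le)
  moreover have "sum v {i \<in> S. cls i mod int L = r} = 0" using True by (simp only: sum.empty)
  ultimately show ?thesis by (intro exI[of _ "{}"]) (simp only: downset_def sum.empty, simp)
next
  case False
  let ?Sr = "{i \<in> S. cls i mod int L = r}"
  have finS: "finite S" using assms(1) finR finite_subset by auto
  define a where "a = Max (cls ` ?Sr)"
  have "a \<in> cls ` ?Sr" unfolding a_def using False finS by (intro Max_in) auto
  then obtain i0 where i0: "i0 \<in> S" "cls i0 mod int L = r" "cls i0 = a" by auto
  have le_a: "cls i \<le> a" if "i \<in> ?Sr" for i
    unfolding a_def using that finS by (intro Max_ge) auto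
  define K where "K = {i \<in> R. cls i = a}"
  define W where "W = {i \<in> R. cls i mod int L = r \<and> cls i < a}"
  have finK: "finite K" "finite W" using finR by (auto simp: K_def W_def)
  have SK: "S \<inter> K \<subseteq> K" "finite (S \<inter> K)" using finS by auto
  obtain Q where Q: "Q \<subseteq> K" "card Q = card (S \<inter> K)" "\<forall>x\<in>Q. \<forall>y\<in>K - Q. rk x < rk y"
    using exists_initial_segment[of K rk "card (S \<inter> K)"] finK SK card_mono[OF finK(1) SK(1)]
      inj_on_subset[OF inj, of K] by (auto simp: K_def)
  have finQ: "finite Q" using finite_subset[OF Q(1) finK(1)] .
  have QW: "Q \<inter> W = {}" using Q by (auto simp: K_def W_def)
  have "downset r (Q \<union> W)"
    unfolding downset_def
  proof (intro conjI ballI impI)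
    show "Q \<union> W \<subseteq> {i \<in> R. cls i mod int L = r}" using Q i0 by (auto simp: K_def W_def)
    fix x y assume x: "x \<in> Q \<union> W" and y: "y \<in> R" "cls y mod int L = r"
      and less: "cls y < cls x \<or> cls y = cls x \<and> rk y < rk x"
    show "y \<in> Q \<union> W"
    proof (cases "cls y < a")
      case True
      with y show ?thesis by (auto simp: W_def)
    next
      case False
      have "x \<notin> W" using False less by (auto simp: W_def)
      hence "x \<in> Q" using x by blast
      hence "cls x = a" using Q(1) by (auto simp: K_def)
      hence "cls y = a" "rk y < rk x" using False less by auto
      moreover from this have "y \<in> K" using y \<open>cls y = a\<close> by (simp add: K_def)
      ultimately have "y \<in> Q" using Q(3) \<open>x \<in> Q\<close> by (meson DiffI less_asym)
      thus ?thesis ..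
    qed
  qed
  moreover have "sum p (Q \<union> W) \<le> 2 * sum p S"
  proof -
    \<comment> \<open>Matching \<open>Q\<close> with \<open>S \<inter> K\<close> inside one class
      costs at most the factor 3/2. The rows of \<open>W\<close> are charged to half the price of
      \<open>i0\<close>, a row of \<open>S \<inter> K\<close>; together this gives the factor
      2.\<close>
    have "card (S \<inter> K) = card Q" using Q by simp
    then obtain h where h: "bij_betw h Q (S \<inter> K)"
      using finite_same_card_bij[OF finQ SK(2)] by auto
    have "sum p Q \<le> (\<Sum>i\<in>Q. 3/2 * p (h i))"
    proof (rule sum_mono)
      fix i assume "i \<in> Q"
      with h have "h i \<in> S \<inter> K" by (auto dest: bij_betwE)
      with \<open>i \<in> Q\<close> Q(1) show "p i \<le> 3/2 * p (h i)" by (intro same) (auto simp: K_def)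
    qed
    also have "\<dots> = 3/2 * sum p (S \<inter> K)"
      unfolding sum_distrib_left[symmetric] sum.reindex_bij_betw[OF h] ..
    finally have pQ: "sum p Q \<le> 3/2 * sum p (S \<inter> K)" .
    have i0R: "i0 \<in> R" using i0 assms(1) by auto
    have cR: "card R > 0" using i0R finR by (auto simp: card_gt_0_iff)
    have "sum p W \<le> (\<Sum>i\<in>W. p i0 / (2 * real (card R)))"
    proof (rule sum_mono)
      fix i assume "i \<in> W"
      hence "2 * real (card R) * p i \<le> p i0" using i0 i0R by (intro lower) (auto simp: W_def)
      thus "p i \<le> p i0 / (2 * real (card R))" using cR by (simp add: field_simps)
    qed
    also have "\<dots> = real (card W) * (p i0 / (2 * real (card R)))" by simp
    also have "\<dots> \<le> real (card R) * (p i0 / (2 * real (card R)))"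
      using p_pos[OF i0R] card_mono[OF finR, of W] by (intro mult_right_mono) (auto simp: W_def)
    also have "\<dots> = p i0 / 2" using cR by simp
    also have "\<dots> \<le> sum p (S \<inter> K) / 2"
      using member_le_sum[of i0 "S \<inter> K" p] i0 i0R SK p_pos by (auto simp: K_def intro: less_imp_le)
    finally have pW: "sum p W \<le> sum p (S \<inter> K) / 2" .
    have "sum p (S \<inter> K) \<le> sum p S"
      using assms(1) p_pos finS by (intro sum_mono2) (auto intro: less_imp_le)
    moreover have "sum p (Q \<union> W) = sum p Q + sum p W"
      by (rule sum.union_disjoint[OF finQ finK(2) QW])
    ultimately show ?thesis using pQ pW by linarith
  qed
  moreover have "sum v ?Sr \<le> sum v (Q \<union> W)"
  proof -
    have split: "sum v ?Sr = sum v (?Sr \<inter> K) + sum v (?Sr - K)"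
      using finS by (intro sum.Int_Diff) auto
    have eq: "?Sr \<inter> K = S \<inter> K" using i0 by (auto simp: K_def)
    \<comment> \<open>\<open>Q\<close> is initial by rank in \<open>K\<close>, so it consists of
      most valuable rows of \<open>K\<close>.\<close>
    have "sum v (S \<inter> K) \<le> sum v Q"
    proof (rule sum_le_sum_initial_segment[OF finK(1) Q(1) SK(1) Q(2)])
      fix x y assume xy: "x \<in> Q" "y \<in> K - Q"
      hence "x \<in> R" "y \<in> R" using Q(1) by (auto simp: K_def)
      thus "v y \<le> v x" using mono Q(3) xy by blast
    qed
    moreover have "sum v (?Sr - K) \<le> sum v W"
    proof (rule sum_mono2[OF finK(2)])
      show "?Sr - K \<subseteq> W"
      proof
        fix i assume i: "i \<in> ?Sr - K"
        hence "i \<in> R" using assms(1) by blast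
        moreover from this i have "cls i \<noteq> a" by (simp add: K_def)
        ultimately show "i \<in> W" using le_a[of i] i by (simp add: W_def)
      qed
    qed (use nonneg in \<open>auto simp: W_def\<close>)
    moreover have "sum v (Q \<union> W) = sum v Q + sum v W"
      by (rule sum.union_disjoint[OF finQ finK(2) QW])
    ultimately show ?thesis unfolding split eq by linarith
  qed
  ultimately show ?thesis by blast
qed

end

section \<open>Existence of a good bid\<close>

lemma sum_slices:
  fixes f :: "nat \<Rightarrow> nat \<Rightarrow> real"
  assumes "S \<subseteq> {..<m} \<times> {..<n}"
  shows "(\<Sum>(i, j)\<in>S. f i j) = (\<Sum>j<n. \<Sum>i | (i, j) \<in> S. f i j)"
proof -
  have mem: "i < m \<and> j < n" if "(i, j) \<in> S" for i j
    using subsetD[OF assms that] by simp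
  have fin: "finite {i. (i, j) \<in> S}" for j
    by (rule finite_subset[of _ "{..<m}"]) (use mem in auto)
  have "(\<Sum>j<n. \<Sum>i | (i, j) \<in> S. f i j) = (\<Sum>(j, i)\<in>Sigma {..<n} (\<lambda>j. {i. (i, j) \<in> S}). f i j)"
    using fin by (intro sum.Sigma) auto
  also have "\<dots> = (\<Sum>(i, j)\<in>S. f i j)"
    by (rule sum.reindex_bij_witness[of _ prod.swap prod.swap]) (use mem in auto)
  finally show ?thesis ..
qed

text \<open>In a chain inclusion is decided by size. Take \<open>b j\<close> to be the size of
  \<open>T j\<close> and \<open>a i\<close> the least size of a set containing
  \<open>i\<close>.\<close>

lemma nested_sets_as_thresholds:
  fixes T :: "nat \<Rightarrow> nat set"
  assumes sub: "\<And>j. j < n \<Longrightarrow> T j \<subseteq> {..<m}"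
    and chain: "\<And>j j'. j < n \<Longrightarrow> j' < n \<Longrightarrow> T j \<subseteq> T j' \<or> T j' \<subseteq> T j"
  shows "\<exists>a b :: nat \<Rightarrow> nat. (\<forall>i. a i \<le> m) \<and> (\<forall>j<n. b j \<le> m) \<and>
    (\<forall>i j. j < n \<longrightarrow> (0 < a i \<and> a i \<le> b j \<longleftrightarrow> i \<in> T j))"
proof -
  define b where "b j = card (T j)" for j
  \<comment> \<open>Rows in no set get 0, which the condition \<open>0 < a i\<close>
    excludes.\<close>
  define a where "a i = (if \<exists>j<n. i \<in> T j then LEAST k. \<exists>j<n. i \<in> T j \<and> b j = k else 0)" for i
  have fin: "finite (T j)" if "j < n" for j using sub[OF that] finite_subset by blast
  have b_le: "b j \<le> m" if "j < n" for j
    using card_mono[OF _ sub[OF that]] by (simp add: b_def)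
  have witness: "\<exists>j0<n. i \<in> T j0 \<and> b j0 = a i" if "\<exists>j<n. i \<in> T j" for i
  proof -
    have "\<exists>j<n. i \<in> T j \<and> b j = (LEAST k. \<exists>j<n. i \<in> T j \<and> b j = k)"
      using that LeastI_ex[of "\<lambda>k. \<exists>j<n. i \<in> T j \<and> b j = k"] by blast
    thus ?thesis using that by (simp add: a_def)
  qed
  have a_le: "a i \<le> m" for i
  proof (cases "\<exists>j<n. i \<in> T j")
    case True
    from witness[OF this] show ?thesis using b_le by metis
  next
    case False
    hence "a i = 0" unfolding a_def by (rule if_not_P)
    thus ?thesis by simp
  qed
  have "0 < a i \<and> a i \<le> b j \<longleftrightarrow> i \<in> T j" if j: "j < n" for i j
  proof (cases "\<exists>j<n. i \<in> T j")
    case True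
    then obtain j0 where j0: "j0 < n" "i \<in> T j0" "b j0 = a i" using witness by blast
    have pos: "0 < a i" using j0 fin by (auto simp: b_def card_gt_0_iff simp flip: j0(3))
    show ?thesis
    proof
      assume le: "0 < a i \<and> a i \<le> b j"
      show "i \<in> T j"
      proof (cases "T j0 \<subseteq> T j")
        case True
        with j0 show ?thesis by auto
      next
        case False
        \<comment> \<open>A subset at least as large as its finite superset equals it, so here too
          membership in \<open>T j0\<close> passes to \<open>T j\<close>.\<close>
        with chain[OF j j0(1)] have "T j \<subseteq> T j0" by blast
        moreover have "card (T j0) \<le> card (T j)" using le j0(3) by (simp add: b_def)
        ultimately have "T j = T j0" using card_seteq[OF fin[OF j0(1)]] by blast
        with j0 show ?thesis by simp
      qed
    next
      assume "i \<in> T j"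
      hence "(LEAST k. \<exists>j<n. i \<in> T j \<and> b j = k) \<le> b j" using j by (intro Least_le) blast
      with True have "a i \<le> b j" by (simp add: a_def)
      with pos show "0 < a i \<and> a i \<le> b j" ..
    qed
  next
    case False
    hence "a i = 0" unfolding a_def by (rule if_not_P)
    with False j show ?thesis by auto
  qed
  with a_le b_le show ?thesis by blast
qed

text \<open>Digits count from the least significant one. A single number thus codes a vector of
  thresholds, and one loop counter enumerates all vectors.\<close>

definition digit :: "nat \<Rightarrow> nat \<Rightarrow> nat \<Rightarrow> nat" where
  "digit b N k = N div b ^ k mod b"

text \<open>Horner scheme: code the shifted vector, multiply by \<open>b\<close> and put
  \<open>d 0\<close> in the lowest place. Hence the enumeration misses no vector.\<close>

lemma exists_number_with_digits:
  assumes "\<And>k. k < K \<Longrightarrow> d k < b" "0 < b"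
  shows "\<exists>N<b ^ K. \<forall>k<K. digit b N k = d k"
  using assms(1)
proof (induction K arbitrary: d)
  case 0
  then show ?case by (intro exI[of _ 0]) simp
next
  case (Suc K)
  obtain N where N: "N < b ^ K" "\<forall>k<K. digit b N k = d (Suc k)"
    using Suc.IH[of "\<lambda>k. d (Suc k)"] Suc.prems by auto
  have d0: "d 0 < b" using Suc.prems by simp
  have dv: "(d 0 + b * N) div b = N" using d0 by simp
  have "d 0 + b * N < b ^ Suc K"
  proof -
    have "d 0 + b * N < b * Suc N" using d0 by simp
    also have "\<dots> \<le> b * b ^ K" using N by (intro mult_le_mono2) simp
    finally show ?thesis by simp
  qed
  moreover have "digit b (d 0 + b * N) k = d k" if "k < Suc K" for k
  proof (cases k)
    case 0
    then show ?thesis using d0 by (simp add: digit_def)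
  next
    case (Suc k')
    then show ?thesis using N(2) that dv by (simp add: digit_def div_mult2_eq)
  qed
  ultimately show ?case by blast
qed

text \<open>
  Bids of rows (k < rows I) and of columns (k - rows I) in one vector. With
  multiplicative prices, cell (i, j) is captured iff the digit of its row is positive and
  at most the digit of its column; a zero row digit gives bid 0 because x / 0 = 0.
\<close>

definition cand :: "mbp \<Rightarrow> nat \<Rightarrow> nat \<Rightarrow> real" where
  "cand I N k =
    (if k < rows I then price I k 0 / real (digit (rows I + 1) N k)
     else price I 0 (k - rows I) / price I 0 0 * real (digit (rows I + 1) N k))"

definition vbid :: "mbp \<Rightarrow> (nat \<Rightarrow> real) \<Rightarrow> (nat \<times> nat) set" where
  "vbid I x = captured I x (\<lambda>j. x (rows I + j))"

lemma multiplicative_pricesE: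
  assumes "multiplicative_prices I"
  obtains p q where "\<And>i. i < rows I \<Longrightarrow> 0 < p i" "\<And>j. j < cols I \<Longrightarrow> 0 < q j"
    "\<And>i j. i < rows I \<Longrightarrow> j < cols I \<Longrightarrow> price I i j = p i * q j"
proof -
  from assms obtain p q where "\<forall>i<rows I. p i > 0" "\<forall>j<cols I. q j > 0"
    "\<forall>(i, j) \<in> cells I. price I i j = p i * q j"
    unfolding multiplicative_prices_def by blast
  thus thesis by (intro that[of p q]) (auto simp: cells_def)
qed

text \<open>The search knows prices but not their factors. First row and first column suffice,
  because the product of \<open>p i * q 0\<close> and \<open>p 0 * q j\<close>, divided by
  \<open>p 0 * q 0\<close>, is \<open>p i * q j\<close>.\<close>

lemma exists_candidate_capturing_nested_sets:
  assumes inst: "mbp_instance I" and "multiplicative_prices I"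
    and sub: "\<And>j. j < cols I \<Longrightarrow> T j \<subseteq> {..<rows I}"
    and chain: "\<And>j j'. j < cols I \<Longrightarrow> j' < cols I \<Longrightarrow> T j \<subseteq> T j' \<or> T j' \<subseteq> T j"
  shows "\<exists>N<(rows I + 1) ^ (rows I + cols I). vbid I (cand I N) = {(i, j). j < cols I \<and> i \<in> T j}"
proof -
  let ?m = "rows I" and ?n = "cols I"
  obtain a b where ab: "\<And>i. a i \<le> ?m" "\<And>j. j < ?n \<Longrightarrow> b j \<le> ?m"
    "\<And>i j. j < ?n \<Longrightarrow> (0 < a i \<and> a i \<le> b j \<longleftrightarrow> i \<in> T j)"
    using nested_sets_as_thresholds[of ?n T ?m] sub chain by metis
  define d where "d k = (if k < ?m then a k else b (k - ?m))" for k
  obtain N where N: "N < (?m + 1) ^ (?m + ?n)" "\<And>k. k < ?m + ?n \<Longrightarrow> digit (?m + 1) N k = d k"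
  proof -
    have "d k < ?m + 1" if "k < ?m + ?n" for k
      using ab(1)[of k] ab(2)[of "k - ?m"] that by (simp add: d_def less_Suc_eq_le)
    thus thesis using that exists_number_with_digits[of "?m + ?n" d "?m + 1"] by auto
  qed
  obtain p q where pq: "\<And>i. i < ?m \<Longrightarrow> 0 < p i" "\<And>j. j < ?n \<Longrightarrow> 0 < q j"
    "\<And>i j. i < ?m \<Longrightarrow> j < ?n \<Longrightarrow> price I i j = p i * q j"
    using multiplicative_pricesE[OF assms(2)] by metis
  have mn: "0 < ?m" "0 < ?n" using inst by (auto simp: mbp_instance_def)
  have "price I i j \<le> cand I N i * cand I N (?m + j) \<longleftrightarrow> i \<in> T j" if i: "i < ?m" and j: "j < ?n" for i j
  proof -
    have dig: "digit (Suc ?m) N i = a i" "digit (Suc ?m) N (?m + j) = b j"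
      using N(2)[of i] N(2)[of "?m + j"] i j by (simp_all add: d_def)
    \<comment> \<open>The bid product is the price times \<open>b j / a i\<close>, so capture means
      that this ratio is at least 1; for \<open>a i = 0\<close> the ratio is 0 and capture
      fails.\<close>
    have "cand I N i * cand I N (?m + j) = p i * q j * (real (b j) / real (a i))"
      using i j mn pq(1)[OF mn(1)] pq(2)[OF mn(2)] by (simp add: cand_def dig pq(3))
    moreover have "p i * q j \<le> p i * q j * (real (b j) / real (a i)) \<longleftrightarrow> 1 \<le> real (b j) / real (a i)"
      using pq(1)[OF i] pq(2)[OF j] mult_le_cancel_left_pos[of "p i * q j" 1 "real (b j) / real (a i)"]
      by simp
    moreover have "1 \<le> real (b j) / real (a i) \<longleftrightarrow> 0 < a i \<and> a i \<le> b j"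
      by (cases "a i = 0") (auto simp: field_simps)
    ultimately show ?thesis using ab(3)[OF j] i j by (simp add: pq(3))
  qed
  hence "vbid I (cand I N) = {(i, j). j < ?n \<and> i \<in> T j}"
    using sub by (auto simp: vbid_def captured_def cells_def)
  with N show ?thesis by blast
qed

text \<open>With \<open>k\<close> the rounded-up binary logarithm, \<open>m\<close> is at most
  \<open>2 ^ k\<close> and hence at most the power \<open>2 * k\<close> of 3/2. Four more factors
  3/2 contribute 81/16, which exceeds 4.\<close>

lemma exists_log_scale:
  assumes "1 \<le> m"
  shows "\<exists>L. (3/2 :: real) ^ L \<ge> 4 * real m \<and> 0 < L \<and> real L \<le> 6 * (1 + log 2 (real m))"
proof -
  define k where "k = nat \<lceil>log 2 (real m)\<rceil>"
  have log0: "0 \<le> log 2 (real m)" using assms by simp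
  hence k: "log 2 (real m) \<le> real k" "real k \<le> log 2 (real m) + 1"
    unfolding k_def by linarith+
  have "real m = 2 powr log 2 (real m)" using assms by simp
  also have "\<dots> \<le> 2 powr real k" using k by (intro powr_mono) auto
  also have "\<dots> = 2 ^ k" by (simp add: powr_realpow)
  also have "\<dots> \<le> (9/4) ^ k" by (intro power_mono) auto
  finally have m: "real m \<le> (9/4) ^ k" .
  have "(3/2 :: real) ^ (2 * k + 4) = (9/4) ^ k * (81/16)"
    by (simp add: power_add power_mult power2_eq_square) (simp add: eval_nat_numeral)
  moreover have "0 \<le> (9/4 :: real) ^ k" by simp
  ultimately have "4 * real m \<le> (3/2) ^ (2 * k + 4)" using m by linarith
  moreover have "real (2 * k + 4) \<le> 6 * (1 + log 2 (real m))" using k log0 by simp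
  ultimately show ?thesis by (intro exI[of _ "2 * k + 4"]) simp
qed

section \<open>Averaging over residues\<close>

text \<open>The constant 24 is the factor 4 lost by thinning times the 6 in the bound on the number
  \<open>L\<close> of residues. Thinning to half the budget pays for the doubling of the price by
  the downsets.\<close>

lemma exists_good_candidate:
  assumes inst: "mbp_instance I" and mult: "multiplicative_prices I" and "monotone_values I"
    and small: "\<And>i j. (i, j) \<in> cells I \<Longrightarrow> price I i j \<le> budget I / 4"
    and S: "S \<subseteq> cells I" "total_price I S \<le> budget I"
  shows "\<exists>N<(rows I + 1) ^ (rows I + cols I). total_price I (vbid I (cand I N)) \<le> budget I \<and>
    total_val I S \<le> 24 * (1 + log 2 (real (rows I))) * total_val I (vbid I (cand I N))"
proof -
  let ?m = "rows I" and ?n = "cols I" and ?B = "budget I"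
  have mn: "1 \<le> ?m" "0 < ?B" and val0: "\<And>i j. i < ?m \<Longrightarrow> j < ?n \<Longrightarrow> 0 \<le> val I i j"
    using inst by (auto simp: mbp_instance_def cells_def)
  have finS: "finite S" using S(1) finite_subset[of S "cells I"] by (simp add: cells_def)
  obtain p q where p: "\<And>i. i < ?m \<Longrightarrow> 0 < p i" and q: "\<And>j. j < ?n \<Longrightarrow> 0 < q j"
    and pq: "\<And>i j. i < ?m \<Longrightarrow> j < ?n \<Longrightarrow> price I i j = p i * q j"
    using multiplicative_pricesE[OF mult] by metis
  obtain \<sigma> where \<sigma>: "\<sigma> permutes {..<?m}"
    and mono: "\<And>i i' j. j < ?n \<Longrightarrow> i < i' \<Longrightarrow> i' < ?m \<Longrightarrow> val I (\<sigma> i') j \<le> val I (\<sigma> i) j"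
    using assms(3) unfolding monotone_values_def by auto
  \<comment> \<open>The inverse of \<sigma> gives each row its position in the common order of
    nonincreasing value.\<close>
  define rk where "rk = inv \<sigma>"
  have rk: "\<sigma> (rk i) = i" "rk i < ?m \<longleftrightarrow> i < ?m" for i
    using permutes_inverses[OF \<sigma>] permutes_in_image[OF permutes_inv[OF \<sigma>], of i]
    by (simp_all add: rk_def)
  have rk_mono: "val I i' j \<le> val I i j" if "i < ?m" "i' < ?m" "j < ?n" "rk i < rk i'" for i i' j
    using mono[of j "rk i" "rk i'"] that rk by simp
  \<comment> \<open>Thinning with \<open>b\<close> equal to a quarter of the budget and
    \<open>k = 4\<close>: the weight bound \<open>2 * b\<close> is half the budget.\<close>
  obtain S' where S': "S' \<subseteq> S" "total_price I S' \<le> ?B / 2" "total_val I S \<le> 4 * total_val I S'"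
    using exists_light_valuable_subset[of S "\<lambda>(i, j). price I i j" "?B / 4" "\<lambda>(i, j). val I i j" 4]
      finS S small mn val0
    by (force simp: total_price_def total_val_def cells_def)
  define Sl where "Sl j = {i. (i, j) \<in> S'}" for j
  have S'_sub: "S' \<subseteq> {..<?m} \<times> {..<?n}" using S' S by (auto simp: cells_def)
  have Sl_sub: "Sl j \<subseteq> {..<?m}" for j using S'_sub by (auto simp: Sl_def)
  obtain L where L: "(3/2 :: real) ^ L \<ge> 4 * real ?m" "0 < L" "real L \<le> 6 * (1 + log 2 (real ?m))"
    using exists_log_scale[OF mn(1)] by auto
  define cls where "cls i = \<lfloor>log (3/2) (p i)\<rfloor>" for i
  interpret row_classes "{..<?m}" p cls rk L
  proof
    show "inj_on rk {..<?m}" by (rule inj_on_inverseI[of _ \<sigma>]) (simp add: rk)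
    fix i i' assume i: "i \<in> {..<?m}" "i' \<in> {..<?m}"
    note * = log_three_halves_classes[of "{..<?m}" p "real ?m" L i i']
    show "p i \<le> 3/2 * p i'" if "cls i = cls i'"
      using *(1) p L mn i that by (simp add: cls_def)
    show "2 * real (card {..<?m}) * p i \<le> p i'" if "cls i < cls i'" "cls i mod int L = cls i' mod int L"
      using *(2) p L mn i that by (simp add: cls_def)
  qed (use p in auto)
  define P where "P r j T \<longleftrightarrow> downset r T \<and> sum p T \<le> 2 * sum p (Sl j) \<and>
      (\<Sum>i | i \<in> Sl j \<and> cls i mod int L = r. val I i j) \<le> (\<Sum>i\<in>T. val I i j)" for r j T
  define T where "T r j = (SOME T. P r j T)" for r j
  have "P r j (T r j)" if "j < ?n" for r j
  proof -
    have "\<exists>T. P r j T"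
      using downset_cover[OF Sl_sub[of j], of "\<lambda>i. val I i j" r] val0 rk_mono that
      unfolding P_def by simp
    thus ?thesis unfolding T_def by (rule someI_ex)
  qed
  hence T: "\<And>r j. j < ?n \<Longrightarrow> downset r (T r j)"
    "\<And>r j. j < ?n \<Longrightarrow> sum p (T r j) \<le> 2 * sum p (Sl j)"
    "\<And>r j. j < ?n \<Longrightarrow> (\<Sum>i | i \<in> Sl j \<and> cls i mod int L = r. val I i j) \<le> (\<Sum>i\<in>T r j. val I i j)"
    by (simp_all add: P_def)
  have T_sub: "T r j \<subseteq> {..<?m}" if "j < ?n" for r j
    using T(1)[OF that, of r] by (auto simp: downset_def)
  define E where "E r = {(i, j). j < ?n \<and> i \<in> T r j}" for r
  have E_sub: "E r \<subseteq> {..<?m} \<times> {..<?n}" for r using T_sub by (auto simp: E_def)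
  have E_slice: "{i. (i, j) \<in> E r} = T r j" if "j < ?n" for r j
    using that by (auto simp: E_def)
  \<comment> \<open>In column \<open>j\<close> every price is \<open>q j\<close> times the row
    factor, so doubling the row factors column by column at most doubles the total price.\<close>
  have price_E: "total_price I (E r) \<le> ?B" for r
  proof -
    have "total_price I (E r) = (\<Sum>j<?n. \<Sum>i\<in>T r j. price I i j)"
      unfolding total_price_def sum_slices[OF E_sub] by (intro sum.cong refl) (simp add: E_slice)
    also have "\<dots> = (\<Sum>j<?n. q j * sum p (T r j))"
      unfolding sum_distrib_left using T_sub pq by (intro sum.cong refl) (force simp: mult.commute)
    also have "\<dots> \<le> (\<Sum>j<?n. q j * (2 * sum p (Sl j)))"
      using q T(2) by (intro sum_mono mult_left_mono) (auto intro: less_imp_le)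
    also have "\<dots> = 2 * (\<Sum>j<?n. q j * sum p (Sl j))"
      by (simp add: sum_distrib_left algebra_simps)
    also have "(\<Sum>j<?n. q j * sum p (Sl j)) = (\<Sum>j<?n. \<Sum>i\<in>Sl j. price I i j)"
      unfolding sum_distrib_left using Sl_sub pq by (intro sum.cong refl) (force simp: mult.commute)
    also have "\<dots> = total_price I S'"
      unfolding total_price_def sum_slices[OF S'_sub] Sl_def ..
    finally show ?thesis using S'(2) by simp
  qed
  have "total_val I S' = (\<Sum>j<?n. \<Sum>i\<in>Sl j. val I i j)"
    unfolding total_val_def sum_slices[OF S'_sub] Sl_def ..
  \<comment> \<open>Each row of a slice belongs to exactly one residue modulo
    \<open>L\<close>.\<close>
  also have "\<dots> = (\<Sum>j<?n. \<Sum>r\<in>{0..<int L}. \<Sum>i | i \<in> Sl j \<and> cls i mod int L = r. val I i j)"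
    using L(2) finite_subset[OF Sl_sub] by (intro sum.cong refl sum.group[symmetric]) auto
  also have "\<dots> \<le> (\<Sum>j<?n. \<Sum>r\<in>{0..<int L}. \<Sum>i\<in>T r j. val I i j)"
    using T(3) by (intro sum_mono) auto
  also have "\<dots> = (\<Sum>r\<in>{0..<int L}. \<Sum>j<?n. \<Sum>i\<in>T r j. val I i j)"
    by (rule sum.swap)
  also have "\<dots> = (\<Sum>r\<in>{0..<int L}. total_val I (E r))"
    unfolding total_val_def sum_slices[OF E_sub] by (intro sum.cong refl) (simp add: E_slice)
  finally have sum_E: "total_val I S' \<le> (\<Sum>r\<in>{0..<int L}. total_val I (E r))" .
  \<comment> \<open>Averaging: if all \<open>L\<close> residues fell below a share
    \<open>1 / L\<close> of the value, their sum would contradict \<open>sum_E\<close>.\<close>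
  obtain r where r: "total_val I S' \<le> real L * total_val I (E r)"
  proof (rule ccontr)
    assume "\<not> thesis"
    hence "total_val I (E r) < total_val I S' / real L" for r
      using that[of r] L(2) by (force simp: field_simps)
    hence "(\<Sum>r\<in>{0..<int L}. total_val I (E r)) < (\<Sum>r\<in>{0..<int L}. total_val I S' / real L)"
      using L(2) by (intro sum_strict_mono) auto
    with sum_E L(2) show False by simp
  qed
  obtain N where N: "N < (?m + 1) ^ (?m + ?n)" "vbid I (cand I N) = E r"
    using exists_candidate_capturing_nested_sets[OF inst mult, of "T r"] T_sub
      downset_chain[OF T(1) T(1)] unfolding E_def by blast
  have E0: "0 \<le> total_val I (E r)"
    unfolding total_val_def using E_sub[of r] val0 by (intro sum_nonneg) auto
  have "total_val I S \<le> 4 * (real L * total_val I (E r))" using S'(3) r by linarith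
  also have "\<dots> \<le> 4 * ((6 * (1 + log 2 (real ?m))) * total_val I (E r))"
    using L(3) E0 by (intro mult_left_mono mult_right_mono) auto
  also have "\<dots> = 24 * (1 + log 2 (real ?m)) * total_val I (E r)" by (simp add: algebra_simps)
  finally show ?thesis using N price_E[of r] by (intro exI[of _ N]) simp
qed

section \<open>Exhaustive search on the real random access machine\<close>

text \<open>Since execution is deterministic, asking for some final store amounts to termination in
  a store satisfying \<open>Q\<close>.\<close>

definition wp :: "prog \<Rightarrow> (store \<Rightarrow> bool) \<Rightarrow> store \<Rightarrow> bool" where
  "wp P Q s \<longleftrightarrow> (\<exists>t. exec P s t \<and> Q t)"

lemma wp_basic [simp]:
  "wp Skip Q s \<longleftrightarrow> Q s"
  "wp (NAssign a e) Q s \<longleftrightarrow> Q (s\<lparr>nmem := (nmem s)(nval a s := nval e s)\<rparr>)"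
  "wp (RAssign a x) Q s \<longleftrightarrow> Q (s\<lparr>rmem := (rmem s)(nval a s := rval x s)\<rparr>)"
  "wp (Cond b P R) Q s \<longleftrightarrow> (if bval b s then wp P Q s else wp R Q s)"
  unfolding wp_def
  by (auto intro: exec.intros elim: exec_SkipE exec_NAssignE exec_RAssignE exec_CondE)

lemma wp_Seq [simp]: "wp (Seq P R) Q s \<longleftrightarrow> wp P (wp R Q) s"
  unfolding wp_def by (blast intro: exec.Seq elim: exec_SeqE)

lemmas wp_simps = wp_basic wp_Seq

lemma wp_mono: "wp P Q s \<Longrightarrow> (\<And>t. Q t \<Longrightarrow> Q' t) \<Longrightarrow> wp P Q' s"
  unfolding wp_def by blast

abbreviation nvar :: "nat \<Rightarrow> nexp" where "nvar v \<equiv> NMem (NConst v)"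

definition for_loop :: "nat \<Rightarrow> nexp \<Rightarrow> prog \<Rightarrow> prog" where
  "for_loop v b P = Seq (NAssign (NConst v) (NConst 0))
     (While (NLess (nvar v) b) (Seq P (NAssign (NConst v) (NAdd (nvar v) (NConst 1)))))"

text \<open>\<open>Inv k\<close> speaks of the store whose counter already is \<open>k\<close>,
  hence the update to \<open>Suc k\<close> after the body. The bound \<open>e\<close> is evaluated
  again in every round, so the invariant has to fix its value.\<close>

lemma wp_for_loop:
  assumes init: "Inv 0 (s\<lparr>nmem := (nmem s)(v := 0)\<rparr>)"
    and step: "\<And>k s. k < b \<Longrightarrow> nmem s v = k \<Longrightarrow> Inv k s \<Longrightarrow>
      wp P (\<lambda>t. nmem t v = k \<and> Inv (Suc k) (t\<lparr>nmem := (nmem t)(v := Suc k)\<rparr>)) s"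
    and bound: "\<And>k s. Inv k s \<Longrightarrow> nval e s = b"
    and post: "\<And>s. Inv b s \<Longrightarrow> Q s"
  shows "wp (for_loop v e P) Q s"
proof -
  let ?P = "Seq P (NAssign (NConst v) (NAdd (nvar v) (NConst 1)))"
  \<comment> \<open>Generalised to an arbitrary starting counter \<open>k\<close> for the induction
    on the number of remaining rounds.\<close>
  have loop: "wp (While (NLess (nvar v) e) ?P) (Inv b) s" if "k \<le> b" "nmem s v = k" "Inv k s" for k s
    using that
  proof (induction "b - k" arbitrary: k s)
    case 0
    have "\<not> bval (NLess (nvar v) e) s" using 0 bound[OF 0(4)] by simp
    hence "exec (While (NLess (nvar v) e) ?P) s s" by (rule exec.WhileFalse)
    moreover have "k = b" using 0 by simp
    ultimately show ?case using 0(4) unfolding wp_def by blast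
  next
    case (Suc d)
    hence k: "k < b" by simp
    hence true: "bval (NLess (nvar v) e) s" using bound[OF Suc(5)] Suc(4) by simp
    obtain t where t: "exec P s t" "nmem t v = k" "Inv (Suc k) (t\<lparr>nmem := (nmem t)(v := Suc k)\<rparr>)"
      using step[OF k Suc(4,5)] unfolding wp_def by blast
    let ?t = "t\<lparr>nmem := (nmem t)(v := Suc k)\<rparr>"
    have "exec (NAssign (NConst v) (NAdd (nvar v) (NConst 1))) t ?t"
      using exec.NAssign[of "NConst v" "NAdd (nvar v) (NConst 1)" t] t(2) by simp
    with t(1) have body: "exec ?P s ?t" by (rule exec.Seq)
    have "wp (While (NLess (nvar v) e) ?P) (Inv b) ?t"
      using Suc.hyps(2) k t(3) by (intro Suc.hyps(1)[of "Suc k"]) auto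
    then obtain u where "exec (While (NLess (nvar v) e) ?P) ?t u" "Inv b u" unfolding wp_def by blast
    with exec.WhileTrue[OF true body] show ?case unfolding wp_def by blast
  qed
  show ?thesis
    unfolding for_loop_def wp_simps
    by (rule wp_mono[OF loop[of 0]]) (use init post in simp_all)
qed

text \<open>
  Natural memory: 0 rows, 1 columns, 2 base address b of the work space, 3 number of candidates,
  4 candidate, 5 loop counter, 6 undecoded digits. Real memory: b price and b + 1 value
  of the current candidate, b + 2 value of the best candidate, then the current and the best bid.
\<close>

definition reg :: "nat \<Rightarrow> nexp" where "reg c = NAdd (nvar 2) (NConst c)"
definition cur_at :: "nexp \<Rightarrow> nexp" where "cur_at k = NAdd (reg 3) k"
definition best_at :: "nexp \<Rightarrow> nexp" where "best_at k = NAdd (NAdd (reg 3) (NAdd (nvar 0) (nvar 1))) k"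

section \<open>The search program and its components\<close>

definition count_prog :: prog where
  "count_prog = Seq (NAssign (NConst 3) (NConst 1))
     (for_loop 5 (NAdd (nvar 0) (nvar 1))
       (NAssign (NConst 3) (NMul (nvar 3) (NAdd (nvar 0) (NConst 1)))))"

text \<open>Address 1 holds the price of cell (0, 0); the addresses computed in the two branches
  hold the prices of the first column and of the first row.\<close>

definition decode_prog :: prog where
  "decode_prog =
    (let dig = ROfNat (NMod (nvar 6) (NAdd (nvar 0) (NConst 1))) in
     Seq (NAssign (NConst 6) (nvar 4))
      (for_loop 5 (NAdd (nvar 0) (nvar 1))
       (Seq (Cond (NLess (nvar 5) (nvar 0))
              (RAssign (cur_at (nvar 5))
                (RDiv (RMem (NAdd (NConst 1) (NMul (nvar 5) (nvar 1)))) dig))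
              (RAssign (cur_at (nvar 5))
                (RMul (RDiv (RMem (NAdd (NConst 1) (NSub (nvar 5) (nvar 0)))) (RMem (NConst 1))) dig)))
            (NAssign (NConst 6) (NDiv (nvar 6) (NAdd (nvar 0) (NConst 1)))))))"

text \<open>One loop runs over all cells: in row-major order, number \<open>l\<close> stands for row
  \<open>l div n\<close> and column \<open>l mod n\<close>, where \<open>n\<close> is the number of
  columns.\<close>

definition eval_prog :: prog where
  "eval_prog =
    (let pr = RMem (NAdd (NConst 1) (nvar 5));
         vl = RMem (NAdd (NAdd (NConst 1) (NMul (nvar 0) (nvar 1))) (nvar 5)) in
     Seq (RAssign (reg 0) (ROfNat (NConst 0))) (Seq (RAssign (reg 1) (ROfNat (NConst 0)))
      (for_loop 5 (NMul (nvar 0) (nvar 1))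
       (Cond (RLess (RMul (RMem (cur_at (NDiv (nvar 5) (nvar 1))))
                          (RMem (cur_at (NAdd (nvar 0) (NMod (nvar 5) (nvar 1)))))) pr)
         Skip
         (Seq (RAssign (reg 0) (RAdd (RMem (reg 0)) pr))
              (RAssign (reg 1) (RAdd (RMem (reg 1)) vl)))))))"

definition update_prog :: prog where
  "update_prog =
    Cond (BAnd (BNot (RLess (RMem (NConst 0)) (RMem (reg 0)))) (RLess (RMem (reg 2)) (RMem (reg 1))))
     (Seq (RAssign (reg 2) (RMem (reg 1)))
       (for_loop 5 (NAdd (nvar 0) (nvar 1)) (RAssign (best_at (nvar 5)) (RMem (cur_at (nvar 5))))))
     Skip"

definition output_prog :: prog where
  "output_prog = for_loop 5 (NAdd (nvar 0) (nvar 1)) (RAssign (nvar 5) (RMem (best_at (nvar 5))))"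

definition search_prog :: prog where
  "search_prog =
    Seq (NAssign (NConst 2) (NAdd (NConst 1) (NMul (NConst 2) (NMul (nvar 0) (nvar 1)))))
     (Seq count_prog
      (Seq (for_loop 4 (nvar 3) (Seq decode_prog (Seq eval_prog update_prog))) output_prog))"

section \<open>Memory invariants and correctness of the components\<close>

definition base :: "mbp \<Rightarrow> nat" where "base I = 1 + 2 * (rows I * cols I)"

definition loaded :: "mbp \<Rightarrow> store \<Rightarrow> bool" where
  "loaded I s \<longleftrightarrow> nmem s 0 = rows I \<and> nmem s 1 = cols I \<and> nmem s 2 = base I \<and>
     (\<forall>a<base I. rmem s a = rmem (input_store I) a)"

text \<open>Frame condition: the natural cells 5 and 6 are scratch, and \<open>X\<close> collects
  the real addresses that may change.\<close>

definition same_outside :: "nat set \<Rightarrow> store \<Rightarrow> store \<Rightarrow> bool" where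
  "same_outside X s t \<longleftrightarrow>
     (\<forall>a. a \<noteq> 5 \<and> a \<noteq> 6 \<longrightarrow> nmem t a = nmem s a) \<and> (\<forall>a. a \<notin> X \<longrightarrow> rmem t a = rmem s a)"

lemma same_outside_loaded:
  "same_outside X s t \<Longrightarrow> loaded I s \<Longrightarrow> (\<And>a. a \<in> X \<Longrightarrow> base I \<le> a) \<Longrightarrow> loaded I t"
  unfolding same_outside_def loaded_def by (simp; metis not_less)

lemma loaded_nmem:
  "loaded I s \<Longrightarrow> nmem s 0 = rows I" "loaded I s \<Longrightarrow> nmem s (Suc 0) = cols I"
  "loaded I s \<Longrightarrow> nmem s 2 = base I"
  by (simp_all add: loaded_def)

lemma loaded_rmem:
  assumes "loaded I s"
  shows "rmem s 0 = budget I"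
    and "i < rows I \<Longrightarrow> j < cols I \<Longrightarrow> rmem s (Suc (i * cols I + j)) = price I i j"
    and "i < rows I \<Longrightarrow> j < cols I \<Longrightarrow> rmem s (Suc (rows I * cols I + (i * cols I + j))) = val I i j"
proof -
  have eq: "rmem s a = rmem (input_store I) a" if "a < base I" for a
    using assms that by (simp add: loaded_def)
  show "rmem s 0 = budget I"
    using eq[of 0] input_store_simps(3)[of I] by (simp add: base_def)
  assume ij: "i < rows I" "j < cols I"
  have "Suc (i * cols I + j) < base I" "Suc (rows I * cols I + (i * cols I + j)) < base I"
    using cell_index_less[OF ij] unfolding base_def by linarith+
  with ij input_store_simps(4,5)[where I = I and i = i and j = j]
  show "rmem s (Suc (i * cols I + j)) = price I i j"
    and "rmem s (Suc (rows I * cols I + (i * cols I + j))) = val I i j"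
    using eq[of "Suc (i * cols I + j)"] eq[of "Suc (rows I * cols I + (i * cols I + j))"]
    by (simp_all add: add.assoc)
qed

lemma wp_count_prog:
  assumes "loaded I s"
  shows "wp count_prog (\<lambda>t. loaded I t \<and> rmem t = rmem s \<and>
    nmem t 3 = (rows I + 1) ^ (rows I + cols I)) s"
  unfolding count_prog_def wp_simps
  by (rule wp_for_loop[where b = "rows I + cols I" and
        Inv = "\<lambda>k t. loaded I t \<and> rmem t = rmem s \<and> nmem t 3 = (rows I + 1) ^ k"])
    (use assms in \<open>auto simp: loaded_def\<close>)

lemma wp_decode_prog:
  assumes ld: "loaded I s" and inst: "mbp_instance I"
  shows "wp decode_prog (\<lambda>t. same_outside {base I + 3..<base I + 3 + (rows I + cols I)} s t \<and>
    (\<forall>k<rows I + cols I. rmem t (base I + 3 + k) = cand I (nmem s 4) k)) s"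
proof -
  let ?X = "{base I + 3..<base I + 3 + (rows I + cols I)}" and ?N = "nmem s 4"
  have mn: "0 < rows I" "0 < cols I" using inst by (auto simp: mbp_instance_def)
  show ?thesis
    unfolding decode_prog_def Let_def wp_simps
  \<comment> \<open>After \<open>k\<close> rounds cell 6 holds the candidate number without its
    \<open>k\<close> lowest digits, so its remainder is digit \<open>k\<close>.\<close>
  proof (rule wp_for_loop[where b = "rows I + cols I" and Inv = "\<lambda>k t. same_outside ?X s t \<and>
      nmem t 6 = ?N div (rows I + 1) ^ k \<and> (\<forall>l<k. rmem t (base I + 3 + l) = cand I ?N l)"])
    fix k t
    assume k: "k < rows I + cols I" "nmem t 5 = k" and
      inv: "same_outside ?X s t \<and> nmem t 6 = ?N div (rows I + 1) ^ k \<and>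
        (\<forall>l<k. rmem t (base I + 3 + l) = cand I ?N l)"
    have lt: "loaded I t" using inv ld by (auto intro: same_outside_loaded)
    note mem = loaded_nmem[OF lt] loaded_rmem(2)[OF lt, of k 0] loaded_rmem(2)[OF lt, of 0 "k - rows I"]
      loaded_rmem(2)[OF lt, of 0 0]
    show "wp (Seq (Cond (NLess (nvar 5) (nvar 0))
              (RAssign (cur_at (nvar 5))
                (RDiv (RMem (NAdd (NConst 1) (NMul (nvar 5) (nvar 1))))
                  (ROfNat (NMod (nvar 6) (NAdd (nvar 0) (NConst 1))))))
              (RAssign (cur_at (nvar 5))
                (RMul (RDiv (RMem (NAdd (NConst 1) (NSub (nvar 5) (nvar 0)))) (RMem (NConst 1)))
                  (ROfNat (NMod (nvar 6) (NAdd (nvar 0) (NConst 1)))))))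
            (NAssign (NConst 6) (NDiv (nvar 6) (NAdd (nvar 0) (NConst 1)))))
       (\<lambda>t. nmem t 5 = k \<and> same_outside ?X s (t\<lparr>nmem := (nmem t)(5 := Suc k)\<rparr>) \<and>
         nmem (t\<lparr>nmem := (nmem t)(5 := Suc k)\<rparr>) 6 = ?N div (rows I + 1) ^ Suc k \<and>
         (\<forall>l<Suc k. rmem (t\<lparr>nmem := (nmem t)(5 := Suc k)\<rparr>) (base I + 3 + l) = cand I ?N l)) t"
      using k inv mn mem
      by (auto simp: cur_at_def reg_def same_outside_def cand_def digit_def less_Suc_eq
          div_mult2_eq[symmetric] mult.commute)
  qed (use ld in \<open>auto simp: same_outside_def loaded_def\<close>)
qed

lemma sum_cells_linear:
  fixes g :: "nat \<Rightarrow> nat \<Rightarrow> real"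
  assumes "0 < n"
  shows "(\<Sum>(i, j)\<in>{..<m} \<times> {..<n}. g i j) = (\<Sum>l<m * n. g (l div n) (l mod n))"
proof (rule sum.reindex_bij_witness[of _ "\<lambda>l. (l div n, l mod n)" "\<lambda>(i, j). i * n + j"])
  show "(l div n, l mod n) \<in> {..<m} \<times> {..<n}" if "l \<in> {..<m * n}" for l
    using assms that by (simp add: less_mult_imp_div_less)
qed (use assms cell_index_less in auto)

text \<open>The form in which \<open>eval_prog\<close> accumulates the sum: over all cell numbers,
  with 0 for a skipped cell.\<close>

lemma sum_captured_linear:
  fixes g :: "nat \<Rightarrow> nat \<Rightarrow> real"
  assumes "0 < cols I"
  shows "(\<Sum>(i, j)\<in>vbid I x. g i j) = (\<Sum>l<rows I * cols I.
    if x (l div cols I) * x (rows I + l mod cols I) < price I (l div cols I) (l mod cols I) then 0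
    else g (l div cols I) (l mod cols I))"
proof -
  have "(\<Sum>(i, j)\<in>vbid I x. g i j) =
      (\<Sum>(i, j)\<in>cells I. if x i * x (rows I + j) < price I i j then 0 else g i j)"
    by (rule sum.mono_neutral_cong_left) 
      (auto simp: vbid_def captured_def cells_def not_less split: if_splits)
  thus ?thesis
    using sum_cells_linear[OF assms, of "\<lambda>i j. if x i * x (rows I + j) < price I i j then 0 else g i j"]
    by (simp add: cells_def)
qed

lemma wp_eval_prog:
  assumes ld: "loaded I s" and inst: "mbp_instance I"
    and x: "\<And>k. k < rows I + cols I \<Longrightarrow> rmem s (base I + 3 + k) = x k"
  shows "wp eval_prog (\<lambda>t. same_outside {base I, base I + 1} s t \<and>
    rmem t (base I) = total_price I (vbid I x) \<and> rmem t (base I + 1) = total_val I (vbid I x)) s"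
proof -
  let ?m = "rows I" and ?n = "cols I" and ?X = "{base I, base I + 1}"
  define G where "G g l = (if x (l div ?n) * x (?m + l mod ?n) < price I (l div ?n) (l mod ?n) then 0
    else g (l div ?n) (l mod ?n))" for g :: "nat \<Rightarrow> nat \<Rightarrow> real" and l
  have mn: "0 < ?m" "0 < ?n" using inst by (auto simp: mbp_instance_def)
  show ?thesis
    unfolding eval_prog_def Let_def wp_simps
  proof (rule wp_for_loop[where b = "?m * ?n" and Inv = "\<lambda>k t. same_outside ?X s t \<and>
      rmem t (base I) = (\<Sum>l<k. G (price I) l) \<and> rmem t (base I + 1) = (\<Sum>l<k. G (val I) l)"])
    fix t
    assume inv: "same_outside ?X s t \<and> rmem t (base I) = (\<Sum>l<?m * ?n. G (price I) l) \<and>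
      rmem t (base I + 1) = (\<Sum>l<?m * ?n. G (val I) l)"
    thus "same_outside ?X s t \<and> rmem t (base I) = total_price I (vbid I x) \<and>
      rmem t (base I + 1) = total_val I (vbid I x)"
      by (simp add: total_price_def total_val_def sum_captured_linear[OF mn(2)] G_def)
  next
    fix k t
    assume k: "k < ?m * ?n" "nmem t 5 = k" and inv: "same_outside ?X s t \<and>
      rmem t (base I) = (\<Sum>l<k. G (price I) l) \<and> rmem t (base I + 1) = (\<Sum>l<k. G (val I) l)"
    have lt: "loaded I t" using inv ld by (auto intro: same_outside_loaded)
    have lt_mn: "k div ?n < ?m" "k mod ?n < ?n" using k(1) mn by (simp_all add: less_mult_imp_div_less)
    have mem: "rmem t (Suc k) = price I (k div ?n) (k mod ?n)"
      "rmem t (Suc (?m * ?n + k)) = val I (k div ?n) (k mod ?n)"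
      using loaded_rmem(2,3)[OF lt lt_mn] by simp_all
    have bids: "rmem t (base I + 3 + l) = x l" if "l < ?m + ?n" for l
      using inv x[OF that] by (simp add: same_outside_def)
    note bids = bids[of "k div ?n"] bids[of "?m + k mod ?n"]
    show "wp (Cond (RLess (RMul (RMem (cur_at (NDiv (nvar 5) (nvar 1))))
                          (RMem (cur_at (NAdd (nvar 0) (NMod (nvar 5) (nvar 1))))))
             (RMem (NAdd (NConst 1) (nvar 5))))
         Skip
         (Seq (RAssign (reg 0) (RAdd (RMem (reg 0)) (RMem (NAdd (NConst 1) (nvar 5)))))
              (RAssign (reg 1) (RAdd (RMem (reg 1))
                (RMem (NAdd (NAdd (NConst 1) (NMul (nvar 0) (nvar 1))) (nvar 5)))))))
       (\<lambda>t. nmem t 5 = k \<and> same_outside ?X s (t\<lparr>nmem := (nmem t)(5 := Suc k)\<rparr>) \<and>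
         rmem (t\<lparr>nmem := (nmem t)(5 := Suc k)\<rparr>) (base I) = (\<Sum>l<Suc k. G (price I) l) \<and>
         rmem (t\<lparr>nmem := (nmem t)(5 := Suc k)\<rparr>) (base I + 1) = (\<Sum>l<Suc k. G (val I) l)) t"
      using k inv lt_mn mem bids loaded_nmem[OF lt]
      by (auto simp: cur_at_def reg_def same_outside_def G_def base_def add.assoc)
  qed (use ld in \<open>auto simp: same_outside_def loaded_def reg_def\<close>)
qed

lemma wp_update_prog:
  assumes ld: "loaded I s"
    and x: "\<And>k. k < rows I + cols I \<Longrightarrow> rmem s (base I + 3 + k) = x k"
  shows "wp update_prog (\<lambda>t. loaded I t \<and> nmem t 3 = nmem s 3 \<and> nmem t 4 = nmem s 4 \<and>
    (if rmem s (base I) \<le> budget I \<and> rmem s (base I + 2) < rmem s (base I + 1)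
     then rmem t (base I + 2) = rmem s (base I + 1) \<and>
       (\<forall>k<rows I + cols I. rmem t (base I + 3 + (rows I + cols I) + k) = x k)
     else rmem t = rmem s)) s"
proof (cases "rmem s (base I) \<le> budget I \<and> rmem s (base I + 2) < rmem s (base I + 1)")
  case False
  then show ?thesis
    using ld loaded_nmem[OF ld] loaded_rmem(1)[OF ld]
    by (auto simp: update_prog_def reg_def)
next
  case True
  let ?K = "rows I + cols I"
  \<comment> \<open>The best bid is stored above the current one, so the entries still to be copied
    remain intact.\<close>
  let ?X = "insert (base I + 2) {base I + 3 + ?K..}"
  have "wp (Seq (RAssign (reg 2) (RMem (reg 1)))
       (for_loop 5 (NAdd (nvar 0) (nvar 1)) (RAssign (best_at (nvar 5)) (RMem (cur_at (nvar 5))))))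
     (\<lambda>t. loaded I t \<and> nmem t 3 = nmem s 3 \<and> nmem t 4 = nmem s 4 \<and>
       rmem t (base I + 2) = rmem s (base I + 1) \<and> (\<forall>k<?K. rmem t (base I + 3 + ?K + k) = x k)) s"
    unfolding wp_simps
  proof (rule wp_for_loop[where b = ?K and Inv = "\<lambda>k t. same_outside ?X s t \<and>
      rmem t (base I + 2) = rmem s (base I + 1) \<and> (\<forall>l<k. rmem t (base I + 3 + ?K + l) = x l)"])
    fix t
    assume inv: "same_outside ?X s t \<and> rmem t (base I + 2) = rmem s (base I + 1) \<and>
      (\<forall>l<?K. rmem t (base I + 3 + ?K + l) = x l)"
    have "loaded I t" using inv ld by (auto intro: same_outside_loaded)
    with inv show "loaded I t \<and> nmem t 3 = nmem s 3 \<and> nmem t 4 = nmem s 4 \<and>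
       rmem t (base I + 2) = rmem s (base I + 1) \<and> (\<forall>k<?K. rmem t (base I + 3 + ?K + k) = x k)"
      by (simp add: same_outside_def)
  next
    fix k t
    assume k: "k < ?K" "nmem t 5 = k" and inv: "same_outside ?X s t \<and>
      rmem t (base I + 2) = rmem s (base I + 1) \<and> (\<forall>l<k. rmem t (base I + 3 + ?K + l) = x l)"
    have lt: "loaded I t" using inv ld by (auto intro: same_outside_loaded)
    have cur: "rmem t (base I + 3 + k) = x k"
      using inv x[OF k(1)] k(1) by (simp add: same_outside_def)
    show "wp (RAssign (best_at (nvar 5)) (RMem (cur_at (nvar 5))))
       (\<lambda>t. nmem t 5 = k \<and> same_outside ?X s (t\<lparr>nmem := (nmem t)(5 := Suc k)\<rparr>) \<and>
         rmem (t\<lparr>nmem := (nmem t)(5 := Suc k)\<rparr>) (base I + 2) = rmem s (base I + 1) \<and>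
         (\<forall>l<Suc k. rmem (t\<lparr>nmem := (nmem t)(5 := Suc k)\<rparr>) (base I + 3 + ?K + l) = x l)) t"
      using k inv cur loaded_nmem[OF lt]
      by (auto simp: best_at_def cur_at_def reg_def same_outside_def less_Suc_eq)
  qed (use ld in \<open>auto simp: same_outside_def loaded_def reg_def\<close>)
  with True show ?thesis
    using loaded_nmem[OF ld] loaded_rmem(1)[OF ld]
    by (simp add: update_prog_def reg_def)
qed

text \<open>The output overwrites the input from address 0 on. Before round \<open>k\<close> only
  addresses below \<open>k\<close> have changed, so the entry to be copied is still intact.\<close>

lemma wp_output_prog:
  assumes ld: "loaded I s"
    and x: "\<And>k. k < rows I + cols I \<Longrightarrow> rmem s (base I + 3 + (rows I + cols I) + k) = x k"
  shows "wp output_prog (\<lambda>t. \<forall>k<rows I + cols I. rmem t k = x k) s"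
  unfolding output_prog_def
proof (rule wp_for_loop[where b = "rows I + cols I" and Inv = "\<lambda>k t. (\<forall>a<3. nmem t a = nmem s a) \<and>
    (\<forall>l<k. rmem t l = x l) \<and> (\<forall>a\<ge>k. rmem t a = rmem s a)"])
qed (use ld x in \<open>auto simp: loaded_def best_at_def reg_def less_Suc_eq\<close>)

lemma cand_nonneg:
  assumes "mbp_instance I" "k < rows I + cols I"
  shows "0 \<le> cand I N k"
proof -
  have "0 < price I i j" if "i < rows I" "j < cols I" for i j
    using assms(1) that by (auto simp: mbp_instance_def cells_def)
  hence "k < rows I \<Longrightarrow> 0 < price I k 0" "\<not> k < rows I \<Longrightarrow> 0 < price I 0 (k - rows I)" "0 < price I 0 0"
    using assms by (simp_all add: mbp_instance_def)
  thus ?thesis unfolding cand_def by (simp add: less_imp_le)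
qed

section \<open>Correctness of the exhaustive search\<close>

text \<open>The bid \<open>x\<close> is arbitrary, so that the zero bid can serve before the first
  candidate is tested.\<close>

definition best_so_far :: "mbp \<Rightarrow> nat \<Rightarrow> (nat \<Rightarrow> real) \<Rightarrow> bool" where
  "best_so_far I N x \<longleftrightarrow> (\<forall>k<rows I + cols I. 0 \<le> x k) \<and> total_price I (vbid I x) \<le> budget I \<and>
    (\<forall>N'<N. total_price I (vbid I (cand I N')) \<le> budget I \<longrightarrow>
      total_val I (vbid I (cand I N')) \<le> total_val I (vbid I x))"

lemma wp_search_prog:
  assumes inst: "mbp_instance I"
  shows "wp search_prog (\<lambda>t. \<exists>x. best_so_far I ((rows I + 1) ^ (rows I + cols I)) x \<and>
    (\<forall>k<rows I + cols I. rmem t k = x k)) (input_store I)"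
proof -
  let ?K = "rows I + cols I" and ?b = "base I" and ?M = "(rows I + 1) ^ (rows I + cols I)"
  let ?s = "(input_store I)\<lparr>nmem := (nmem (input_store I))(2 := ?b)\<rparr>"
  have pos: "0 < price I i j" if "(i, j) \<in> cells I" for i j
    using inst that by (auto simp: mbp_instance_def)
  have ld0: "loaded I ?s" using input_store_simps(1-3)[of I] by (simp add: loaded_def)
  \<comment> \<open>Memory beyond the input is zero, so the work space already contains the zero bid
    as best bid, with value 0.\<close>
  have zero: "rmem (input_store I) a = 0" if "?b \<le> a" for a
  proof -
    have "\<not> a - 1 < 2 * (rows I * cols I)" "\<not> a - 1 < rows I * cols I" "a \<noteq> 0"
      using that by (simp_all add: base_def)
    thus ?thesis by (simp add: input_store_def Let_def)
  qed
  \<comment> \<open>After \<open>N\<close> rounds the input is intact, and the stored best bid and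
    value are right for all candidates below \<open>N\<close>.\<close>
  define Inv where "Inv N t \<longleftrightarrow> loaded I t \<and> nmem t 3 = ?M \<and>
    (\<exists>x. best_so_far I N x \<and> rmem t (?b + 2) = total_val I (vbid I x) \<and>
      (\<forall>k<?K. rmem t (?b + 3 + ?K + k) = x k))" for N t
  have main: "wp (for_loop 4 (nvar 3) (Seq decode_prog (Seq eval_prog update_prog))) (Inv ?M) s"
    if s: "loaded I s" "rmem s = rmem ?s" "nmem s 3 = ?M" for s
  proof (rule wp_for_loop[where b = ?M and Inv = Inv])
    \<comment> \<open>All prices are positive, so the zero bid captures nothing and is
      feasible.\<close>
    have empty: "vbid I (\<lambda>_. 0) = {}"
      using pos by (auto simp: vbid_def captured_def not_le)
    have "best_so_far I 0 (\<lambda>_. 0)"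
      using inst by (simp add: best_so_far_def empty total_price_def mbp_instance_def)
    thus "Inv 0 (s\<lparr>nmem := (nmem s)(4 := 0)\<rparr>)"
      using s zero empty by (auto simp: Inv_def loaded_def total_val_def intro!: exI[of _ "\<lambda>_. 0"])
  next
    fix N s
    assume N: "N < ?M" "nmem s 4 = N" and inv: "Inv N s"
    from inv obtain x where ls: "loaded I s" and s3: "nmem s 3 = ?M" and x: "best_so_far I N x"
      "rmem s (?b + 2) = total_val I (vbid I x)" "\<forall>k<?K. rmem s (?b + 3 + ?K + k) = x k"
      unfolding Inv_def by blast
    let ?c = "cand I N"
    have "wp update_prog (\<lambda>u. nmem u 4 = N \<and> Inv (Suc N) (u\<lparr>nmem := (nmem u)(4 := Suc N)\<rparr>)) t"
      if t: "loaded I t" "nmem t 3 = ?M" "nmem t 4 = N" "\<forall>k<?K. rmem t (?b + 3 + k) = ?c k"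
        "rmem t ?b = total_price I (vbid I ?c)" "rmem t (?b + 1) = total_val I (vbid I ?c)"
        "rmem t (?b + 2) = total_val I (vbid I x)" "\<forall>k<?K. rmem t (?b + 3 + ?K + k) = x k" for t
    proof (rule wp_mono[OF wp_update_prog[OF t(1), of ?c]])
      show "rmem t (?b + 3 + k) = ?c k" if "k < ?K" for k using t(4) that by blast
      fix u
      assume u: "loaded I u \<and> nmem u 3 = nmem t 3 \<and> nmem u 4 = nmem t 4 \<and>
        (if rmem t ?b \<le> budget I \<and> rmem t (?b + 2) < rmem t (?b + 1)
         then rmem u (?b + 2) = rmem t (?b + 1) \<and> (\<forall>k<?K. rmem u (?b + 3 + ?K + k) = ?c k)
         else rmem u = rmem t)"
      have "\<exists>y. best_so_far I (Suc N) y \<and> rmem u (?b + 2) = total_val I (vbid I y) \<and>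
        (\<forall>k<?K. rmem u (?b + 3 + ?K + k) = y k)"
      proof (cases "rmem t ?b \<le> budget I \<and> rmem t (?b + 2) < rmem t (?b + 1)")
        case True
        have "best_so_far I (Suc N) ?c"
          using True x(1) t(5-7) cand_nonneg[OF inst]
          by (force simp: best_so_far_def less_Suc_eq)
        with True u t(6) show ?thesis by (intro exI[of _ ?c]) simp
      next
        case False
        have "best_so_far I (Suc N) x"
          using False x(1) t(5-7) by (auto simp: best_so_far_def less_Suc_eq)
        moreover have "rmem u = rmem t" using u False by auto
        ultimately show ?thesis using t(7,8) by (intro exI[of _ x]) simp
      qed
      with u t(2,3) show "nmem u 4 = N \<and> Inv (Suc N) (u\<lparr>nmem := (nmem u)(4 := Suc N)\<rparr>)"
        by (simp add: Inv_def loaded_def)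
    qed
    note upd = this
    have "wp eval_prog (wp update_prog
        (\<lambda>u. nmem u 4 = N \<and> Inv (Suc N) (u\<lparr>nmem := (nmem u)(4 := Suc N)\<rparr>))) t"
      if t: "same_outside {?b + 3..<?b + 3 + ?K} s t" "\<forall>k<?K. rmem t (?b + 3 + k) = ?c k" for t
    proof -
      have lt: "loaded I t" using t(1) ls by (auto intro: same_outside_loaded)
      show ?thesis
      proof (rule wp_mono[OF wp_eval_prog[OF lt inst, of ?c]])
        show "rmem t (?b + 3 + k) = ?c k" if "k < ?K" for k using t(2) that by blast
        fix u
        assume u: "same_outside {?b, ?b + 1} t u \<and> rmem u ?b = total_price I (vbid I ?c) \<and>
          rmem u (?b + 1) = total_val I (vbid I ?c)"
        have lu: "loaded I u" using u lt by (auto intro: same_outside_loaded)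
        show "wp update_prog (\<lambda>u. nmem u 4 = N \<and> Inv (Suc N) (u\<lparr>nmem := (nmem u)(4 := Suc N)\<rparr>)) u"
          by (rule upd) (use lu u t x(2,3) s3 N(2) in \<open>simp_all add: same_outside_def\<close>)
      qed
    qed
    with wp_decode_prog[OF ls inst]
    show "wp (Seq decode_prog (Seq eval_prog update_prog))
        (\<lambda>u. nmem u 4 = N \<and> Inv (Suc N) (u\<lparr>nmem := (nmem u)(4 := Suc N)\<rparr>)) s"
      unfolding wp_simps N(2) by (elim wp_mono) blast
  qed (simp_all add: Inv_def)
  have out: "wp output_prog (\<lambda>t. \<exists>x. best_so_far I ?M x \<and> (\<forall>k<?K. rmem t k = x k)) t"
    if inv: "Inv ?M t" for t
  proof -
    from inv obtain x where "loaded I t" "best_so_far I ?M x" "\<forall>k<?K. rmem t (?b + 3 + ?K + k) = x k"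
      unfolding Inv_def by blast
    thus ?thesis using wp_output_prog[of I t x] by (auto elim!: wp_mono)
  qed
  have start: "(input_store I)\<lparr>nmem := (nmem (input_store I))
      (nval (NConst 2) (input_store I) :=
       nval (NAdd (NConst 1) (NMul (NConst 2) (NMul (nvar 0) (nvar 1)))) (input_store I))\<rparr> = ?s"
    using input_store_simps(1,2)[of I] by (simp add: base_def)
  show ?thesis
    unfolding search_prog_def wp_simps start
    by (rule wp_mono[OF wp_count_prog[OF ld0]]) (blast intro: wp_mono[OF main] out)
qed

section \<open>Comparison with the individual optimum\<close>

text \<open>The greatest prefix length exists because the empty prefix is within the budget. So
  \<open>OPT\<close> is the value of an affordable set, and \<open>exists_good_candidate\<close>
  bounds the value of every such set.\<close>

lemma OPT_eq_total_val:
  assumes "mbp_instance I" "ratio_order I xs"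
  shows "\<exists>S\<subseteq>cells I. total_price I S \<le> budget I \<and> OPT I xs = total_val I S"
proof -
  let ?P = "\<lambda>k. k \<le> length xs \<and> total_price I (set (take k xs)) \<le> budget I"
  have "?P (GREATEST k. ?P k)"
    using assms(1) by (intro GreatestI_nat[of ?P 0 "length xs"])
      (auto simp: total_price_def mbp_instance_def)
  moreover have "set (take k xs) \<subseteq> cells I" for k
    using assms(2) set_take_subset[of k xs] by (simp add: ratio_order_def)
  ultimately show ?thesis unfolding OPT_def Let_def by blast
qed

theorem theorem2:
  fixes \<epsilon> :: real
  assumes "0 < \<epsilon>" and "\<epsilon> < 1/4"
  shows "\<exists>C>0. \<exists>A::prog. \<forall>I::mbp.
    mbp_instance I \<and> multiplicative_prices I \<and> monotone_values I \<and>
    (\<forall>(i, j) \<in> cells I. price I i j < \<epsilon> * budget I) \<longrightarrow>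
    (\<exists>r c. outputs_bid A I r c \<and> feasible_bid I r c \<and>
       (\<forall>xs. ratio_order I xs \<longrightarrow>
          bid_value I r c \<ge> OPT I xs / (C * (1 + log 2 (real (rows I))))))"
proof (intro exI[of _ "24 :: real"] conjI exI[of _ search_prog] allI impI)
  fix I :: mbp
  assume H: "mbp_instance I \<and> multiplicative_prices I \<and> monotone_values I \<and>
    (\<forall>(i, j) \<in> cells I. price I i j < \<epsilon> * budget I)"
  hence inst: "mbp_instance I" by simp
  let ?m = "rows I" and ?K = "rows I + cols I"
  obtain t x where t: "exec search_prog (input_store I) t" "\<forall>k<?K. rmem t k = x k"
    and x: "best_so_far I ((?m + 1) ^ ?K) x"
    using wp_search_prog[OF inst] unfolding wp_def by blast
  have budget: "0 < budget I" "1 \<le> ?m" using inst by (auto simp: mbp_instance_def)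
  \<comment> \<open>Here \<epsilon> < 1/4 enters: single prices are at most a quarter of the budget,
    the size bound used in thinning.\<close>
  have small: "price I i j \<le> budget I / 4" if "(i, j) \<in> cells I" for i j
  proof -
    have "price I i j < \<epsilon> * budget I" using H that by auto
    also have "\<dots> \<le> 1/4 * budget I" using assms budget by (intro mult_right_mono) auto
    finally show ?thesis by simp
  qed
  define c where "c j = x (?m + j)" for j
  have cap: "captured I x c = vbid I x" by (simp add: vbid_def c_def[abs_def])
  have "outputs_bid search_prog I x c"
    using t by (auto simp: outputs_bid_def c_def)
  moreover have "feasible_bid I x c"
    using x by (auto simp: feasible_bid_def mult_bid_def cap best_so_far_def c_def)
  \<comment> \<open>The bid is fixed before \<open>xs\<close>, so one output serves every way of
    breaking ties.\<close>
  moreover have "OPT I xs / (24 * (1 + log 2 (real ?m))) \<le> bid_value I x c" if xs: "ratio_order I xs" for xs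
  proof -
    obtain S where S: "S \<subseteq> cells I" "total_price I S \<le> budget I" "OPT I xs = total_val I S"
      using OPT_eq_total_val[OF inst xs] by blast
    obtain N where N: "N < (?m + 1) ^ ?K" "total_price I (vbid I (cand I N)) \<le> budget I"
      "total_val I S \<le> 24 * (1 + log 2 (real ?m)) * total_val I (vbid I (cand I N))"
      using exists_good_candidate[OF inst _ _ small S(1,2)] H by blast
    have "0 \<le> log 2 (real ?m)" using budget(2) by simp
    hence log: "0 < 24 * (1 + log 2 (real ?m))" by (simp add: add_pos_nonneg)
    have "OPT I xs / (24 * (1 + log 2 (real ?m))) \<le> total_val I (vbid I (cand I N))"
      using N(3) log unfolding S(3) by (simp only: pos_divide_le_eq mult.commute)
    also have "\<dots> \<le> total_val I (vbid I x)" using x N(1,2) by (simp add: best_so_far_def)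
    finally show ?thesis by (simp add: bid_value_def cap)
  qed
  ultimately show "\<exists>r c. outputs_bid search_prog I r c \<and> feasible_bid I r c \<and>
       (\<forall>xs. ratio_order I xs \<longrightarrow>
          bid_value I r c \<ge> OPT I xs / (24 * (1 + log 2 (real (rows I)))))"
    by blast
qed simp

end
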